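(* Let $x^+\in G(x,v)$ be a stochastic difference inclusion on $\mathcal X\subseteq\mathbb R^n$ with random inputs in $\mathcal V\subseteq\mathbb R^m$, satisfying the standing assumptions (A1)–(A4) and the i.i.d. assumption listed in the context. Let $B:\mathcal X\to\mathbb R_{\ge0}$ be upper semicontinuous, $\Delta>0$, $K_\Delta=\{x\in\mathcal X: B(x)\le\Delta\}$, $K_\Delta^C=\mathcal X\setminus K_\Delta$, $N\in\mathbb N$, $\rho\in[0,1)$ and $x\in K_\Delta$. If $$\sum_{i=1}^N\ell_i^B(x)\le\rho\Delta,\qquad \ell_i^B(x):=\mathbb E\big[\lambda_i^B(x,v_0,\dots,v_{i-1})\big],$$ then the probability of reaching $K_\Delta^C$ from $x$ within $N$ steps is less than $\rho$, i.e. $$\mathbb P\big(\exists k\in\{1,\dots,N\}:\ \lambda_k^B(x,v_0,\dots,v_{k-1})>\Delta\big)<\rho.$$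
   Context: Setting. $G:\mathcal X\times\mathcal V\rightrightarrows\mathbb R^n$ is a set-valued map with $G(x,v)\subseteq\mathcal X$. Assumptions on $G$: (A1) for each $v\in\mathcal V$, $x\mapsto G(x,v)$ is upper semicontinuous, meaning that for every $x$ and $\epsilon>0$ there is a neighborhood $U(x)$ with $G(y,v)\subseteq G(x,v)+\epsilon\mathbb B$ for all $y\in U(x)\cap\mathcal X$ ($\mathbb B$ the open unit ball); (A2) $G$ is locally bounded: each point of $\mathcal X\times\mathcal V$ has a neighborhood on which all elements of the values of $G$ are bounded in norm by a common constant; (A3) each $G(x,v)$ is nonempty, closed and convex; (A4) $v\mapsto\operatorname{graph}(G(\cdot,v))=\{(x,y)\in\mathcal X\times\mathcal X: y\in G(x,v)\}$ is a measurable set-valued map (preimages $\{v:\operatorname{graph}(G(\cdot,v))\cap O\ne\emptyset\}$ of open sets $O$ are measurable). I.i.d. assumption: $(v_i)_{i\ge0}$ are i.i.d. random vectors on a probability space $(\Omega,\mathcal F,\mathbb P)$ with values in $\mathcal V$ and common distribution $\mu$ on the Borel sets of $\mathcal V$. Functions $\lambda_k^B:\mathcal X\times\mathcal V^k\to\mathbb R_{\ge0}$: $\lambda_0^B(x)=B(x)$ and $\lambda_{k+1}^B(x,v_0,\dots,v_k)=\sup_{x_1\in G(x,v_0)}\lambda_k^B(x_1,v_1,\dots,v_k)$. The set $K_\Delta^C$ can be reached at step $k$ from $x$ for inputs $v_0,\dots,v_{k-1}$ (some trajectory $x_0=x$, $x_{i+1}\in G(x_i,v_i)$ has $x_k\in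 K_\Delta^C$) iff $\lambda_k^B(x,v_0,\dots,v_{k-1})>\Delta$.
   Formalization: The strict bound fails at ρ = 0 (take B = 0: the probability is 0 and 0 < 0 is false); the formal theorem proves probability < ρ for every ρ in (0,1), and only probability ≤ ρ, i.e. = 0, when ρ = 0. *)

theory Defs
  imports "HOL-Probability.Probability"
begin

text \<open>
  Maps on \<open>X\<close>, \<open>V\<close> or \<open>X \<times> V\<close> are total functions on the ambient types; only their values on these
  domains are constrained or used. All topological notions are relative to the domains.
\<close>

definition usc_on :: "'a::topological_space set \<Rightarrow> ('a \<Rightarrow> real) \<Rightarrow> bool" where
  "usc_on X f \<longleftrightarrow> (\<forall>x\<in>X. \<forall>c. f x < c \<longrightarrow> (\<exists>U. open U \<and> x \<in> U \<and> (\<forall>y\<in>U \<inter> X. f y < c)))"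

definition set_usc_on :: "'a::topological_space set \<Rightarrow> ('a \<Rightarrow> 'b::real_normed_vector set) \<Rightarrow> bool" where
  "set_usc_on X F \<longleftrightarrow>
     (\<forall>x\<in>X. \<forall>e>0. \<exists>U. open U \<and> x \<in> U \<and>
        (\<forall>y\<in>U \<inter> X. F y \<subseteq> {a + b | a b. a \<in> F x \<and> b \<in> ball 0 e}))"

definition set_locally_bounded_on ::
    "'a::topological_space set \<Rightarrow> ('a \<Rightarrow> 'b::real_normed_vector set) \<Rightarrow> bool" where
  "set_locally_bounded_on D F \<longleftrightarrow>
     (\<forall>p\<in>D. \<exists>U c. open U \<and> p \<in> U \<and> (\<forall>q\<in>U \<inter> D. \<forall>z\<in>F q. norm z \<le> c))"

definition set_graph :: "'a set \<Rightarrow> ('a \<Rightarrow> 'a set) \<Rightarrow> ('a \<times> 'a) set" where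
  "set_graph X F = {(x, y). x \<in> X \<and> y \<in> X \<and> y \<in> F x}"

definition set_measurable :: "'a measure \<Rightarrow> ('a \<Rightarrow> 'b::topological_space set) \<Rightarrow> bool" where
  "set_measurable M F \<longleftrightarrow> (\<forall>O'. open O' \<longrightarrow> {v \<in> space M. F v \<inter> O' \<noteq> {}} \<in> sets M)"

text \<open>
  The standing assumptions on the data of a difference inclusion; \<open>restrict_space borel V\<close> carries
  the Borel sets of \<open>V\<close> and has space \<open>V\<close>.
\<close>

definition difference_inclusion ::
    "(real^'n) set \<Rightarrow> (real^'m) set \<Rightarrow> (real^'n \<Rightarrow> real^'m \<Rightarrow> (real^'n) set) \<Rightarrow> bool" where
  "difference_inclusion X V G \<longleftrightarrow>
     (\<forall>x\<in>X. \<forall>v\<in>V. G x v \<subseteq> X) \<and>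
     (\<forall>v\<in>V. set_usc_on X (\<lambda>x. G x v)) \<and>
     set_locally_bounded_on (X \<times> V) (\<lambda>(x, v). G x v) \<and>
     (\<forall>x\<in>X. \<forall>v\<in>V. G x v \<noteq> {} \<and> closed (G x v) \<and> convex (G x v)) \<and>
     set_measurable (restrict_space borel V) (\<lambda>v. set_graph X (\<lambda>x. G x v))"

definition iid_inputs ::
    "'w measure \<Rightarrow> (real^'m) set \<Rightarrow> (real^'m) measure \<Rightarrow> (nat \<Rightarrow> 'w \<Rightarrow> real^'m) \<Rightarrow> bool" where
  "iid_inputs P V \<mu> v \<longleftrightarrow>
     prob_space P \<and>
     prob_space.indep_vars P (\<lambda>_. restrict_space borel V) v UNIV \<and>
     (\<forall>i. distr P (restrict_space borel V) (v i) = \<mu>)"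

text \<open>
  The input sequence is passed whole, but \<open>reach_bound G B k x v\<close> depends only on \<open>v 0, \<dots>, v (k - 1)\<close>.
  The supremum is taken in \<open>[0, \<infinity>]\<close>, so that it needs no boundedness proviso. Under the standing
  assumptions \<open>G x (v 0)\<close> is nonempty and compact and an upper semicontinuous \<open>B\<close> is bounded on it,
  so the values are finite there.
\<close>

primrec reach_bound ::
    "('a \<Rightarrow> 'b \<Rightarrow> 'a set) \<Rightarrow> ('a \<Rightarrow> real) \<Rightarrow> nat \<Rightarrow> 'a \<Rightarrow> (nat \<Rightarrow> 'b) \<Rightarrow> ennreal" where
  "reach_bound G B 0 x v = ennreal (B x)"
| "reach_bound G B (Suc k) x v = (SUP y\<in>G x (v 0). reach_bound G B k y (\<lambda>i. v (Suc i)))"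

text \<open>
  A nonnegative integral: an infinite expectation has value \<open>\<infinity>\<close>, whereas the Bochner integral would
  give 0.
\<close>

definition expected_reach_bound ::
    "'w measure \<Rightarrow> (nat \<Rightarrow> 'w \<Rightarrow> 'b) \<Rightarrow> ('a \<Rightarrow> 'b \<Rightarrow> 'a set) \<Rightarrow> ('a \<Rightarrow> real) \<Rightarrow> nat \<Rightarrow> 'a \<Rightarrow> ennreal"
  where
  "expected_reach_bound P v G B i x = (\<integral>\<^sup>+\<omega>. reach_bound G B i x (\<lambda>j. v j \<omega>) \<partial>P)"

end

theory Submission
  imports Defs
begin

text \<open>
  If the exit event occurs then some \<open>\<lambda>\<^sub>i\<close>, hence the sum of all of them, exceeds \<open>\<Delta>\<close>; Markov's
  inequality, strict because the sum is strictly larger than \<open>\<Delta>\<close> on the event, gives the bound.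
  This needs \<open>\<lambda>\<^sub>k\<close> to be measurable in the inputs, although \<open>X\<close> need not be closed. The
  superlevel sets of \<open>\<lambda>\<^sub>k\<close> are countable unions of events ``some trajectory ends in \<open>C\<close>'' with \<open>C\<close> relatively closed. By compactness of the values and upper
  semicontinuity, such a trajectory exists iff for every \<open>\<epsilon> = 1/n\<close> there is an \<open>\<epsilon>\<close>-chain of
  graph points, and \<open>\<epsilon>\<close>-chains can be indexed by a countable dense set, so their existence is
  decided by countably many events ``the graph meets an open set''.
\<close>

section \<open>Exact reachability of a set\<close>

primrec can_reach ::
    "('a \<Rightarrow> 'b \<Rightarrow> 'a set) \<Rightarrow> 'a set \<Rightarrow> nat \<Rightarrow> 'a \<Rightarrow> (nat \<Rightarrow> 'b) \<Rightarrow> bool" where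
  "can_reach G C 0 x v \<longleftrightarrow> x \<in> C"
| "can_reach G C (Suc k) x v \<longleftrightarrow> (\<exists>y\<in>G x (v 0). can_reach G C k y (\<lambda>i. v (Suc i)))"

text \<open>A supremum lies strictly above \<open>a\<close> iff one of its members does, attained or
  not; strictness thus turns the nested suprema into the existence of a trajectory.\<close>

lemma less_reach_bound_iff:
  "a < reach_bound G B k x v \<longleftrightarrow> can_reach G {y. a < ennreal (B y)} k x v"
  by (induction k arbitrary: x v) (auto simp: less_SUP_iff)

lemma can_reach_UN:
  "can_reach G (\<Union>i\<in>I. C i) k x v \<longleftrightarrow> (\<exists>i\<in>I. can_reach G (C i) k x v)"
  by (induction k arbitrary: x v) auto

text \<open>Trajectories from \<open>X\<close> stay in \<open>X\<close>, so a target can be cut down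
  to \<open>X\<close>, where upper semicontinuity of \<open>B\<close> has topological
  consequences.\<close>

lemma can_reach_Int_domain:
  assumes "\<And>y u. y \<in> X \<Longrightarrow> u \<in> V \<Longrightarrow> G y u \<subseteq> X" and "x \<in> X" and "\<And>j. v j \<in> V"
  shows "can_reach G (X \<inter> C) k x v \<longleftrightarrow> can_reach G C k x v"
  using assms(2,3)
proof (induction k arbitrary: x v)
  case (Suc k)
  have "can_reach G (X \<inter> C) k y (\<lambda>i. v (Suc i)) = can_reach G C k y (\<lambda>i. v (Suc i))"
    if "y \<in> G x (v 0)" for y
  proof (rule Suc.IH)
    show "y \<in> X" using assms(1)[OF Suc.prems] that by blast
  qed (rule Suc.prems)
  then show ?case by auto
qed auto

section \<open>Approximate chains and their limits\<close>

text \<open>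
  A chain of graph points whose consecutive ends agree up to \<open>2 * e\<close>: both lie within \<open>e\<close> of a
  common center. All centers but the first are taken from \<open>D\<close>.
\<close>

primrec approx_reach ::
    "'a set \<Rightarrow> 'a set \<Rightarrow> real \<Rightarrow> ('a::metric_space \<Rightarrow> 'b \<Rightarrow> 'a set) \<Rightarrow> 'a set \<Rightarrow> nat \<Rightarrow> 'a \<Rightarrow> (nat \<Rightarrow> 'b) \<Rightarrow> bool"
  where
  "approx_reach D X e G C 0 u v \<longleftrightarrow> (\<exists>c\<in>C. dist u c < e)"
| "approx_reach D X e G C (Suc k) u v \<longleftrightarrow>
     (\<exists>w\<in>D. set_graph X (\<lambda>x. G x (v 0)) \<inter> (ball u e \<times> ball w e) \<noteq> {} \<and>
        approx_reach D X e G C k w (\<lambda>i. v (Suc i)))"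

text \<open>Density supplies a center near each later state of an exact trajectory. The start
  \<open>x\<close> is only required to be near \<open>u\<close> because the induction continues from
  a state \<open>y\<close> whose center \<open>w\<close> is merely close to it.\<close>

lemma can_reach_imp_approx_reach:
  assumes inv: "\<And>y u. y \<in> X \<Longrightarrow> u \<in> V \<Longrightarrow> G y u \<subseteq> X"
    and dense: "\<And>U. open U \<Longrightarrow> U \<noteq> {} \<Longrightarrow> \<exists>d\<in>D. d \<in> U"
    and "0 < e" and "x \<in> X" and "\<And>j. v j \<in> V" and "dist u x < e" and "can_reach G C k x v"
  shows "approx_reach D X e G C k u v"
  using assms(4-)
proof (induction k arbitrary: x u v)
  case 0
  then show ?case by auto
next
  case (Suc k)
  then obtain y where y: "y \<in> G x (v 0)" "can_reach G C k y (\<lambda>i. v (Suc i))" by auto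
  have "y \<in> X" using inv[OF \<open>x \<in> X\<close> Suc.prems(2)] y(1) by blast
  obtain w where w: "w \<in> D" "w \<in> ball y e"
    using dense[of "ball y e"] \<open>0 < e\<close> by auto
  have "approx_reach D X e G C k w (\<lambda>i. v (Suc i))"
    using Suc.IH[OF \<open>y \<in> X\<close> _ _ y(2)] Suc.prems w by (simp add: dist_commute)
  moreover have "(x, y) \<in> set_graph X (\<lambda>x. G x (v 0)) \<inter> (ball u e \<times> ball w e)"
    using Suc.prems y w \<open>y \<in> X\<close> by (auto simp: set_graph_def dist_commute)
  ultimately show ?case unfolding approx_reach.simps using w(1) by blast
qed

text \<open>Semicontinuity drives \<open>b n\<close> towards the compact set \<open>F x\<close>,
  where sequential compactness applies. The limit is found inside \<open>F x\<close>, which later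
  keeps it in \<open>X\<close>.\<close>

lemma set_usc_on_limit:
  fixes F :: "'a::topological_space \<Rightarrow> 'b::real_normed_vector set"
  assumes usc: "set_usc_on X F" and "x \<in> X" and K: "compact (F x)"
    and a: "a \<longlonglongrightarrow> x" "\<And>n. a n \<in> X" and b: "\<And>n. b n \<in> F (a n)"
  obtains r :: "nat \<Rightarrow> nat" and z where "strict_mono r" "z \<in> F x" "(b \<circ> r) \<longlonglongrightarrow> z"
proof -
  have near: "\<forall>\<^sub>F n in sequentially. \<exists>c\<in>F x. dist (b n) c < e" if "0 < e" for e :: real
  proof -
    obtain U where U: "open U" "x \<in> U"
      "\<forall>y\<in>U \<inter> X. F y \<subseteq> {a + b | a b. a \<in> F x \<and> b \<in> ball 0 e}"
      using usc[unfolded set_usc_on_def, rule_format, OF \<open>x \<in> X\<close> \<open>0 < e\<close>] by blast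
    have "\<forall>\<^sub>F n in sequentially. a n \<in> U" using a(1) U(1,2) by (rule topological_tendstoD)
    then show ?thesis
    proof eventually_elim
      case (elim n)
      then have "b n \<in> {a + b | a b. a \<in> F x \<and> b \<in> ball 0 e}" using U(3) a(2) b by blast
      then obtain c d where "b n = c + d" "c \<in> F x" "norm d < e" by auto
      then show ?case by (intro bexI[of _ c]) (auto simp: dist_norm)
    qed
  qed
  have ne: "F x \<noteq> {}" using eventually_happens[OF near[of 1]] by auto
  \<comment> \<open>The points given by \<open>near\<close> depend on the tolerance
    \<open>e\<close>; nearest points form one sequence that serves all tolerances.\<close>
  have "\<exists>c\<in>F x. \<forall>y\<in>F x. dist (b n) c \<le> dist (b n) y" for n
    by (intro continuous_attains_inf K ne continuous_intros)
  then obtain c where c: "\<And>n. c n \<in> F x" "\<And>n y. y \<in> F x \<Longrightarrow> dist (b n) (c n) \<le> dist (b n) y"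
    by metis
  have lim: "(\<lambda>n. dist (b n) (c n)) \<longlonglongrightarrow> 0"
  proof (rule tendstoI)
    fix e :: real assume "0 < e"
    from near[OF this] show "\<forall>\<^sub>F n in sequentially. dist (dist (b n) (c n)) 0 < e"
      by eventually_elim (auto intro: le_less_trans[OF c(2)])
  qed
  obtain z r where r: "z \<in> F x" "strict_mono (r :: nat \<Rightarrow> nat)" "(c \<circ> r) \<longlonglongrightarrow> z"
    using K c(1) unfolding compact_def by metis
  have "(\<lambda>n. (c \<circ> r) n - (b \<circ> r) n) \<longlonglongrightarrow> 0"
    by (rule Lim_null_comparison[OF _ LIMSEQ_subseq_LIMSEQ[OF lim r(2)]])
      (auto simp: dist_norm norm_minus_commute)
  then have "(b \<circ> r) \<longlonglongrightarrow> z" using Lim_transform2[OF r(3)] by blast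
  with r that show ?thesis by blast
qed

text \<open>The first graph points start ever closer to \<open>x\<close>, so a subsequence of their
  ends, and with it the centers \<open>w\<close>, converges to some \<open>z\<close> in
  \<open>G x (v 0)\<close>; the rest of the trajectory starts there. Each step passes to a
  subsequence, hence the general sequences \<open>e\<close> and \<open>u\<close>.\<close>

lemma approx_reach_limit:
  fixes G :: "'a::real_normed_vector \<Rightarrow> 'b \<Rightarrow> 'a set"
  assumes inv: "\<And>y u. y \<in> X \<Longrightarrow> u \<in> V \<Longrightarrow> G y u \<subseteq> X"
    and usc: "\<And>u. u \<in> V \<Longrightarrow> set_usc_on X (\<lambda>x. G x u)"
    and cpt: "\<And>y u. y \<in> X \<Longrightarrow> u \<in> V \<Longrightarrow> compact (G y u)"
    and C: "closedin (top_of_set X) C"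
    and "x \<in> X" and "\<And>j. v j \<in> V" and "e \<longlonglongrightarrow> 0" and "u \<longlonglongrightarrow> x"
    and "\<And>n. approx_reach D X (e n) G C k (u n) v"
  shows "can_reach G C k x v"
  using assms(5-)
proof (induction k arbitrary: x u v e)
  case 0
  then have "\<forall>n. \<exists>c. c \<in> C \<and> dist (u n) c < e n" by auto
  then obtain c where c: "\<And>n. c n \<in> C" "\<And>n. dist (u n) (c n) < e n" by metis
  have "(\<lambda>n. u n - c n) \<longlonglongrightarrow> 0"
    by (rule Lim_null_comparison[OF _ \<open>e \<longlonglongrightarrow> 0\<close>])
      (use c(2) in \<open>auto simp: dist_norm less_imp_le\<close>)
  then have "c \<longlonglongrightarrow> x" using Lim_transform2[OF \<open>u \<longlonglongrightarrow> x\<close>] by blast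
  \<comment> \<open>\<open>C\<close> is closed only relative to \<open>X\<close>, so a limit in its
    closure belongs to \<open>C\<close> because it is also in \<open>X\<close>.\<close>
  then have "x \<in> closure C" using c(1) closure_sequential by blast
  then show ?case using C \<open>x \<in> X\<close> by (auto simp: closedin_closed closure_def islimpt_Un
      dest: closure_minimal[THEN subsetD, rotated])
next
  case (Suc k)
  have v0: "v 0 \<in> V" by (rule Suc.prems)
  have "\<exists>a b w. a \<in> X \<and> b \<in> G a (v 0) \<and> dist (u n) a < e n \<and> dist w b < e n \<and>
      approx_reach D X (e n) G C k w (\<lambda>i. v (Suc i))" for n
    using Suc.prems(5)[of n] by (fastforce simp: set_graph_def)
  then obtain a b w where abw: "\<And>n. a n \<in> X" "\<And>n. b n \<in> G (a n) (v 0)"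
    "\<And>n. dist (u n) (a n) < e n" "\<And>n. dist (w n) (b n) < e n"
    "\<And>n. approx_reach D X (e n) G C k (w n) (\<lambda>i. v (Suc i))"
    by metis
  have "(\<lambda>n. u n - a n) \<longlonglongrightarrow> 0"
    by (rule Lim_null_comparison[OF _ \<open>e \<longlonglongrightarrow> 0\<close>])
      (use abw(3) in \<open>auto simp: dist_norm less_imp_le\<close>)
  then have ax: "a \<longlonglongrightarrow> x" using Lim_transform2[OF \<open>u \<longlonglongrightarrow> x\<close>] by blast
  obtain r z where r: "strict_mono (r :: nat \<Rightarrow> nat)" "z \<in> G x (v 0)" "(b \<circ> r) \<longlonglongrightarrow> z"
    using set_usc_on_limit[OF usc[OF v0] \<open>x \<in> X\<close> cpt[OF \<open>x \<in> X\<close> v0] ax abw(1,2)] by blast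
  have er: "(e \<circ> r) \<longlonglongrightarrow> 0" using LIMSEQ_subseq_LIMSEQ[OF \<open>e \<longlonglongrightarrow> 0\<close> r(1)] .
  have "(\<lambda>n. (b \<circ> r) n - (w \<circ> r) n) \<longlonglongrightarrow> 0"
    by (rule Lim_null_comparison[OF _ er])
      (use abw(4) in \<open>auto simp: dist_norm less_imp_le norm_minus_commute\<close>)
  then have wr: "(w \<circ> r) \<longlonglongrightarrow> z" using Lim_transform2[OF r(3)] by blast
  have "z \<in> X" using inv[OF \<open>x \<in> X\<close> Suc.prems(2)] r(2) by blast
  have "can_reach G C k z (\<lambda>i. v (Suc i))"
    by (rule Suc.IH[OF \<open>z \<in> X\<close> _ er wr]) (use Suc.prems abw(5) in auto)
  with r show ?case by auto
qed

section \<open>Measurability in the inputs\<close>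

lemma approx_reach_measurable:
  fixes G :: "'a::metric_space \<Rightarrow> 'b \<Rightarrow> 'a set"
  assumes "countable D" and graph: "set_measurable N (\<lambda>u. set_graph X (\<lambda>x. G x u))"
    and "\<And>j. v j \<in> measurable M N"
  shows "Measurable.pred M (\<lambda>\<omega>. approx_reach D X e G C k u (\<lambda>j. v j \<omega>))"
  using assms(3)
proof (induction k arbitrary: u v)
  case (Suc k)
  have [measurable]: "v 0 \<in> measurable M N" by (rule Suc.prems)
  have [measurable]: "Measurable.pred M (\<lambda>\<omega>. approx_reach D X e G C k w (\<lambda>i. v (Suc i) \<omega>))" for w
    using Suc.IH[of "\<lambda>i. v (Suc i)"] Suc.prems by blast
  \<comment> \<open>For a fixed center \<open>w\<close> the product of balls is open, so this is an
    event of the kind \<open>set_measurable\<close> provides; the quantifier over \<open>w\<close>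
    is then a countable union.\<close>
  have [measurable]:
    "Measurable.pred N (\<lambda>s. set_graph X (\<lambda>x. G x s) \<inter> (ball u e \<times> ball w e) \<noteq> {})" for w
    using graph by (auto simp: set_measurable_def pred_def open_Times)
  show ?case
    using \<open>countable D\<close> by simp
qed simp

text \<open>Exact reachability is the countable intersection over the tolerances
  \<open>inverse (real (Suc n))\<close>; the limit argument runs with the constant start
  \<open>x\<close>.\<close>

lemma can_reach_measurable:
  fixes G :: "'a::{real_normed_vector, second_countable_topology} \<Rightarrow> 'b \<Rightarrow> 'a set"
  assumes inv: "\<And>y u. y \<in> X \<Longrightarrow> u \<in> space N \<Longrightarrow> G y u \<subseteq> X"
    and usc: "\<And>u. u \<in> space N \<Longrightarrow> set_usc_on X (\<lambda>x. G x u)"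
    and cpt: "\<And>y u. y \<in> X \<Longrightarrow> u \<in> space N \<Longrightarrow> compact (G y u)"
    and graph: "set_measurable N (\<lambda>u. set_graph X (\<lambda>x. G x u))"
    and C: "closedin (top_of_set X) C" and "x \<in> X"
    and v: "\<And>j. v j \<in> measurable M N"
  shows "Measurable.pred M (\<lambda>\<omega>. can_reach G C k x (\<lambda>j. v j \<omega>))"
proof -
  obtain D :: "'a set" where D: "countable D" "\<And>U. open U \<Longrightarrow> U \<noteq> {} \<Longrightarrow> \<exists>d\<in>D. d \<in> U"
    using countable_dense_setE by metis
  have "can_reach G C k x (\<lambda>j. v j \<omega>) \<longleftrightarrow>
      (\<forall>n. approx_reach D X (inverse (real (Suc n))) G C k x (\<lambda>j. v j \<omega>))" (is "?L \<longleftrightarrow> ?R")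
    if "\<omega> \<in> space M" for \<omega>
  proof
    have vN: "v j \<omega> \<in> space N" for j using v that by (rule measurable_space)
    show ?R if ?L
      using can_reach_imp_approx_reach[OF inv D(2) _ \<open>x \<in> X\<close> vN _ that] by simp
    show ?L if ?R
      by (rule approx_reach_limit[OF inv usc cpt C \<open>x \<in> X\<close> vN LIMSEQ_inverse_real_of_nat
            tendsto_const that[THEN spec]])
  qed
  moreover have "Measurable.pred M
      (\<lambda>\<omega>. \<forall>n. approx_reach D X (inverse (real (Suc n))) G C k x (\<lambda>j. v j \<omega>))"
    using approx_reach_measurable[OF D(1) graph v] by measurable
  ultimately show ?thesis by (simp cong: measurable_cong)
qed

lemma usc_on_closedin_superlevel:
  assumes "usc_on X B"
  shows "closedin (top_of_set X) {y \<in> X. c \<le> B y}"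
proof -
  have "openin (top_of_set X) {y \<in> X. B y < c}"
  proof (subst openin_subopen, safe)
    fix y assume "y \<in> X" "B y < c"
    then obtain U where "open U" "y \<in> U" "\<forall>z\<in>U \<inter> X. B z < c"
      using assms unfolding usc_on_def by blast
    then show "\<exists>T. openin (top_of_set X) T \<and> y \<in> T \<and> T \<subseteq> {y \<in> X. B y < c}"
      using \<open>y \<in> X\<close> by (intro exI[of _ "X \<inter> U"]) (auto simp: openin_open_Int)
  qed
  moreover have "X - {y \<in> X. c \<le> B y} = {y \<in> X. B y < c}" by auto
  ultimately show ?thesis by (auto simp: closedin_def)
qed

lemma reach_bound_measurable:
  fixes G :: "'a::{real_normed_vector, second_countable_topology} \<Rightarrow> 'b \<Rightarrow> 'a set"
  assumes inv: "\<And>y u. y \<in> X \<Longrightarrow> u \<in> space N \<Longrightarrow> G y u \<subseteq> X"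
    and usc: "\<And>u. u \<in> space N \<Longrightarrow> set_usc_on X (\<lambda>x. G x u)"
    and cpt: "\<And>y u. y \<in> X \<Longrightarrow> u \<in> space N \<Longrightarrow> compact (G y u)"
    and graph: "set_measurable N (\<lambda>u. set_graph X (\<lambda>x. G x u))"
    and B: "usc_on X B" and "x \<in> X"
    and v: "\<And>j. v j \<in> measurable M N"
  shows "(\<lambda>\<omega>. reach_bound G B k x (\<lambda>j. v j \<omega>)) \<in> borel_measurable M"
proof (rule borel_measurableI_greater)
  fix a :: ennreal
  \<comment> \<open>A strict superlevel set of \<open>B\<close> need not be relatively closed, but
    it is the union of these sets, which are. The case \<open>a = top\<close> is separate because
    \<open>enn2real top = 0\<close>; its event is empty.\<close>
  define C where "C n = {y \<in> X. enn2real a + inverse (real (Suc n)) \<le> B y}" for n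
  have C: "X \<inter> {y. a < ennreal (B y)} = (\<Union>n. C n)" if "a \<noteq> top"
  proof -
    have "a < ennreal b \<longleftrightarrow> (\<exists>n. enn2real a + inverse (real (Suc n)) \<le> b)" for b
    proof -
      have "a < ennreal b \<longleftrightarrow> enn2real a < b"
        using that by (cases a) (auto simp: ennreal_less_iff)
      also have "\<dots> \<longleftrightarrow> (\<exists>n. enn2real a + inverse (real (Suc n)) \<le> b)"
      proof
        assume "enn2real a < b"
        then obtain n where "inverse (real (Suc n)) < b - enn2real a"
          using reals_Archimedean[of "b - enn2real a"] by auto
        then show "\<exists>n. enn2real a + inverse (real (Suc n)) \<le> b" by (intro exI[of _ n]) simp
      next
        assume "\<exists>n. enn2real a + inverse (real (Suc n)) \<le> b"
        then obtain n where "enn2real a + inverse (real (Suc n)) \<le> b" ..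
        moreover have "0 < inverse (real (Suc n))" by simp
        ultimately show "enn2real a < b" by linarith
      qed
      finally show ?thesis .
    qed
    then show ?thesis by (auto simp: C_def)
  qed
  have "Measurable.pred M (\<lambda>\<omega>. a < reach_bound G B k x (\<lambda>j. v j \<omega>))"
  proof (cases "a = top")
    case False
    have "a < reach_bound G B k x (\<lambda>j. v j \<omega>) \<longleftrightarrow> (\<exists>n. can_reach G (C n) k x (\<lambda>j. v j \<omega>))"
      if "\<omega> \<in> space M" for \<omega>
    proof -
      have "can_reach G {y. a < ennreal (B y)} k x (\<lambda>j. v j \<omega>) \<longleftrightarrow>
          can_reach G (\<Union>n. C n) k x (\<lambda>j. v j \<omega>)"
        unfolding C[OF False, symmetric]
        by (rule can_reach_Int_domain[OF inv \<open>x \<in> X\<close> measurable_space[OF v that], symmetric])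
      then show ?thesis by (simp add: less_reach_bound_iff can_reach_UN)
    qed
    moreover have "Measurable.pred M (\<lambda>\<omega>. can_reach G (C n) k x (\<lambda>j. v j \<omega>))" for n
      unfolding C_def
      by (rule can_reach_measurable[OF inv usc cpt graph usc_on_closedin_superlevel[OF B] \<open>x \<in> X\<close> v])
    ultimately show ?thesis by (simp cong: measurable_cong)
  qed simp
  then show "{\<omega> \<in> space M. a < reach_bound G B k x (\<lambda>j. v j \<omega>)} \<in> sets M"
    by (simp add: pred_def)
qed

lemma difference_inclusion_compact:
  assumes "difference_inclusion X V G" "x \<in> X" "u \<in> V"
  shows "compact (G x u)"
proof -
  have bdd: "set_locally_bounded_on (X \<times> V) (\<lambda>(x, v). G x v)" and xu: "(x, u) \<in> X \<times> V"
    using assms by (auto simp: difference_inclusion_def)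
  from bdd[unfolded set_locally_bounded_on_def, THEN bspec, OF xu]
  obtain U c where "(x, u) \<in> U" "\<forall>q\<in>U \<inter> X \<times> V. \<forall>z\<in>(case q of (x, v) \<Rightarrow> G x v). norm z \<le> c"
    by (elim exE conjE)
  then have "\<forall>z\<in>G x u. norm z \<le> c" using assms(2,3) by auto
  then have "bounded (G x u)" unfolding bounded_iff by blast
  then show ?thesis using assms by (auto simp: compact_eq_bounded_closed difference_inclusion_def)
qed

text \<open>Markov's inequality with a strict gap on \<open>A\<close>: if \<open>A\<close> has
  positive measure, the integral of \<open>f\<close> strictly exceeds
  \<open>d * measure M A\<close>. If \<open>A\<close> is null, strictness can only come from
  \<open>0 < r\<close>.\<close>

lemma (in finite_measure) measure_less_of_nn_integral_le:
  assumes f: "f \<in> borel_measurable M" and "0 < d" and "0 \<le> r"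
    and int: "(\<integral>\<^sup>+\<omega>. f \<omega> \<partial>M) \<le> ennreal (r * d)"
    and A: "A \<in> sets M" and gt: "\<And>\<omega>. \<omega> \<in> A \<Longrightarrow> ennreal d < f \<omega>"
  shows "measure M A \<le> r" and "0 < r \<Longrightarrow> measure M A < r"
proof -
  let ?g = "\<lambda>\<omega>. ennreal d * indicator A \<omega>"
  have int_g: "(\<integral>\<^sup>+\<omega>. ?g \<omega> \<partial>M) = ennreal (d * measure M A)"
    using A \<open>0 < d\<close> by (simp add: nn_integral_cmult_indicator emeasure_eq_measure ennreal_mult)
  have lt: "measure M A < r" if "0 < measure M A"
  proof -
    have "(\<integral>\<^sup>+\<omega>. ?g \<omega> \<partial>M) < (\<integral>\<^sup>+\<omega>. f \<omega> \<partial>M)"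
    proof (rule nn_integral_less)
      show "AE \<omega> in M. ?g \<omega> \<le> f \<omega>"
        using gt by (auto simp: indicator_def less_imp_le)
      \<comment> \<open>On \<open>A\<close> the reverse inequality fails everywhere, so its holding
        almost everywhere would make \<open>A\<close> null.\<close>
      show "\<not> (AE \<omega> in M. f \<omega> \<le> ?g \<omega>)"
      proof
        assume "AE \<omega> in M. f \<omega> \<le> ?g \<omega>"
        then have "AE \<omega> in M. \<omega> \<notin> A"
          by eventually_elim (use gt in \<open>force simp: not_le[symmetric]\<close>)
        then have "emeasure M A = 0"
          using AE_iff_measurable[OF A, of "\<lambda>\<omega>. \<omega> \<notin> A"] sets.sets_into_space[OF A] by blast
        with that show False by (simp add: emeasure_eq_measure)
      qed
    qed (use f A int_g in simp_all)
    then have "ennreal (d * measure M A) < ennreal (r * d)" using int_g int by simp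
    then show ?thesis using \<open>0 < d\<close> \<open>0 \<le> r\<close> by (simp add: ennreal_less_iff mult.commute)
  qed
  show "measure M A \<le> r" "0 < r \<Longrightarrow> measure M A < r"
    using lt \<open>0 \<le> r\<close> by (cases "measure M A = 0"; simp add: zero_less_measure_iff less_imp_le)+
qed

text \<open>For \<open>\<rho> = 0\<close> a strict bound is impossible, as \<open>p\<close> is
  nonnegative; the conclusion then says \<open>p = 0\<close>. For positive \<open>\<rho>\<close> it
  is the strict bound.\<close>

theorem lemma16:
  fixes X :: "(real^'n) set" and V :: "(real^'m) set"
    and G :: "real^'n \<Rightarrow> real^'m \<Rightarrow> (real^'n) set"
    and P :: "'w measure" and \<mu> :: "(real^'m) measure" and v :: "nat \<Rightarrow> 'w \<Rightarrow> real^'m"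
    and B :: "real^'n \<Rightarrow> real" and \<Delta> \<rho> :: real and N :: nat and x :: "real^'n"
  assumes "difference_inclusion X V G"
    and "iid_inputs P V \<mu> v"
    and "\<forall>y\<in>X. 0 \<le> B y" and "usc_on X B"
    and "0 < \<Delta>" and "0 \<le> \<rho>" and "\<rho> < 1"
    and "x \<in> {y \<in> X. B y \<le> \<Delta>}"
    and "(\<Sum>i=1..N. expected_reach_bound P v G B i x) \<le> ennreal (\<rho> * \<Delta>)"
  defines "p \<equiv> measure P {\<omega> \<in> space P.
      \<exists>k\<in>{1..N}. reach_bound G B k x (\<lambda>j. v j \<omega>) > ennreal \<Delta>}"
  shows "p \<le> \<rho> \<and> (0 < \<rho> \<longrightarrow> p < \<rho>)"
proof -
  let ?R = "\<lambda>i \<omega>. reach_bound G B i x (\<lambda>j. v j \<omega>)"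
  let ?N = "restrict_space borel V :: (real^'m) measure"
  interpret prob_space P using assms(2) by (simp add: iid_inputs_def)
  have space: "space ?N = V" by (simp add: space_restrict_space)
  have "v j \<in> measurable P ?N" for j
    using assms(2) by (auto simp: iid_inputs_def indep_vars_def)
  then have R [measurable]: "?R i \<in> borel_measurable P" for i
    using assms(1,4,8) difference_inclusion_compact[OF assms(1)]
    by (intro reach_bound_measurable[where X = X and N = ?N]) (auto simp: space difference_inclusion_def)
  define A where "A = {\<omega> \<in> space P. \<exists>k\<in>{1..N}. ennreal \<Delta> < ?R k \<omega>}"
  have A: "A \<in> sets P" unfolding A_def by measurable
  have gt: "ennreal \<Delta> < (\<Sum>i=1..N. ?R i \<omega>)" if \<omega>: "\<omega> \<in> A" for \<omega>
  proof -
    obtain k where k: "k \<in> {1..N}" "ennreal \<Delta> < ?R k \<omega>" using \<omega> unfolding A_def by blast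
    note k(2)
    also have "?R k \<omega> \<le> (\<Sum>i=1..N. ?R i \<omega>)" using k(1) by (intro member_le_sum) auto
    finally show ?thesis .
  qed
  \<comment> \<open>Exchanging integral and finite sum relies on the measurability fact
    \<open>R\<close>.\<close>
  have "(\<integral>\<^sup>+\<omega>. (\<Sum>i=1..N. ?R i \<omega>) \<partial>P) \<le> ennreal (\<rho> * \<Delta>)"
    using assms(9) by (simp add: expected_reach_bound_def nn_integral_sum)
  from measure_less_of_nn_integral_le[OF _ assms(5,6) this A gt]
  show ?thesis unfolding p_def A_def by simp
qed

end
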